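(* Let $a,b,m\in\mathbb{Z}$ with $a\ge 2$, $m>1$, $\gcd(b,m)=1$, and $b\ge -(a-2)m-2$, and let $S=S_{a,b}(m)$. Let $n$ be the smallest positive integer such that $A_n\ge m$. Then \[ \operatorname{PF}(S)\subseteq\left\{\sum_{i=1}^{n-1} u_i s_i - m\ \middle|\ \mathbf{u}=(u_1,\ldots,u_{n-1})\in\operatorname{Maximals}_{\preceq_{\mathbb{N}^{n-1}}}\mathcal{R}_m(a)\right\}, \] where $\preceq_{\mathbb{N}^{n-1}}$ denotes the product (componentwise) order on $\mathbb{N}^{n-1}$ and $\operatorname{Maximals}$ denotes the set of maximal elements with respect to that order.
   Context: $\mathbb{N}=\{0,1,2,\dots\}$. Let $T_{a,b}(z)=az+b$, with $T_{a,b}^i$ its $i$-fold composition ($T_{a,b}^0$ the identity), and let $S_{a,b}(m)=\langle T_{a,b}^i(m)\mid i\ge 0\rangle$ be the submonoid of $(\mathbb{N},+)$ generated by the orbit of $m$; under the stated hypotheses it is a numerical semigroup (finite complement in $\mathbb{N}$) whose smallest positive element is $m$. Set $d=(a-1)m+b$, $A_i=(a^i-1)/(a-1)$ for $i\ge 0$, and $s_i=T_{a,b}^i(m)=m+dA_i$. Since $m>1$, $n\ge 2$. A pseudo-Frobenius number of $S$ is an integer $x\notin S$ such that $x+s\in S$ for all $s\in S\setminus\{0\}$; $\operatorname{PF}(S)$ is the set of them. $R(a,n)$ is the set of $\mathbf{u}=(u_1,\ldots,u_{n-1})\in\mathbb{N}^{n-1}$ such that $0\le u_j\le a$ for all $j$,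 and if $u_j=a$ then $u_k=0$ for every $k<j$. Define $\mathcal{R}_m(a)=\{\mathbf{u}\in R(a,n)\mid \sum_{i=1}^{n-1}u_iA_i<m\}$. *)

theory Defs
  imports HOL.Hull "HOL-Library.FuncSet"
begin

definition T_map :: "int \<Rightarrow> int \<Rightarrow> int \<Rightarrow> int" where
  "T_map a b z = a * z + b"

(* Submonoids of (N,+), with N viewed as the nonnegative part of the integers:
   pseudo-Frobenius numbers may be negative. *)
definition nat_submonoid :: "int set \<Rightarrow> bool" where
  "nat_submonoid M \<longleftrightarrow> M \<subseteq> {0..} \<and> 0 \<in> M \<and> (\<forall>x\<in>M. \<forall>y\<in>M. x + y \<in> M)"

(* Meaningful only if the orbit of m lies in N; otherwise the hull is UNIV. *)
definition S_monoid :: "int \<Rightarrow> int \<Rightarrow> int \<Rightarrow> int set" where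
  "S_monoid a b m = nat_submonoid hull (range (\<lambda>i. (T_map a b ^^ i) m))"

definition PF :: "int set \<Rightarrow> int set" where
  "PF M = {x. x \<notin> M \<and> (\<forall>s \<in> M - {0}. x + s \<in> M)}"

(* The division is exact for a \<ge> 2. *)
definition A_seq :: "int \<Rightarrow> nat \<Rightarrow> int" where
  "A_seq a i = (a ^ i - 1) div (a - 1)"

(* Tuples (u_1, ..., u_{n-1}) of naturals are extensional functions on {1..<n}. *)
definition R_set :: "int \<Rightarrow> nat \<Rightarrow> (nat \<Rightarrow> nat) set" where
  "R_set a n = {u \<in> {1..<n} \<rightarrow>\<^sub>E (UNIV :: nat set).
     (\<forall>j\<in>{1..<n}. int (u j) \<le> a) \<and>
     (\<forall>j\<in>{1..<n}. int (u j) = a \<longrightarrow> (\<forall>k\<in>{1..<n}. k < j \<longrightarrow> u k = 0))}"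

definition R_below :: "int \<Rightarrow> int \<Rightarrow> nat \<Rightarrow> (nat \<Rightarrow> nat) set" where
  "R_below m a n = {u \<in> R_set a n. (\<Sum>i\<in>{1..<n}. int (u i) * A_seq a i) < m}"

(* On extensional functions the pointwise order of functions is the componentwise
   order of tuples, as all values outside {1..<n} coincide. *)
definition Maximals :: "'a::order set \<Rightarrow> 'a set" where
  "Maximals X = {x \<in> X. \<not> (\<exists>y\<in>X. x < y)}"

end

theory Submission
  imports Defs
begin

text \<open>
  An element of \<open>S\<close> that is a sum of \<open>c\<close> generators \<open>s\<^sub>i = m + d A\<^sub>i\<close> has the form
  \<open>c m + d t\<close>, where \<open>t\<close> is a sum of \<open>c\<close> numbers \<open>A\<^sub>i\<close>. The elements of \<open>R(a,n)\<close> are the greedy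
  expansions of the numbers below \<open>A\<^sub>n\<close>, and a greedy expansion uses the fewest summands.
  As \<open>d \<ge> m - 2\<close>, replacing \<open>t\<close> by \<open>t + q m\<close> with \<open>q > 0\<close> never pays off, so
  \<open>\<R>\<^sub>m(a)\<close> parametrises the Apery set of \<open>S\<close> with respect to \<open>m\<close>. If \<open>x\<close> is pseudo-Frobenius,
  then \<open>x + m\<close> lies in the Apery set, and a larger tuple in \<open>\<R>\<^sub>m(a)\<close> would contradict
  \<open>x + s \<in> S\<close>, where \<open>s\<close> is the difference of the two Apery elements.
\<close>

section \<open>Submonoids generated by sequences\<close>

lemma nat_submonoid_sum_list:
  assumes "nat_submonoid M" "\<And>x. x \<in> set xs \<Longrightarrow> f x \<in> M"
  shows "sum_list (map f xs) \<in> M"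
  using assms(2) by (induction xs) (use assms(1) in \<open>auto simp: nat_submonoid_def\<close>)

lemma nat_submonoid_mult:
  assumes "nat_submonoid M" "x \<in> M"
  shows "int k * x \<in> M"
  by (induction k) (use assms in \<open>auto simp: nat_submonoid_def algebra_simps\<close>)

lemma nat_submonoid_sum:
  assumes "nat_submonoid M" "\<And>i. i \<in> I \<Longrightarrow> f i \<in> M"
  shows "(\<Sum>i\<in>I. int (u i) * f i) \<in> M"
  using assms(2)
proof (induction I rule: infinite_finite_induct)
  case (insert i I)
  then show ?case
    using assms(1) nat_submonoid_mult[OF assms(1), of "f i" "u i"]
    by (auto simp: nat_submonoid_def)
qed (use assms(1) in \<open>auto simp: nat_submonoid_def\<close>)

text \<open>Indexing the sums by lists allows repeated generators and makes the number of summands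
  available as \<open>length\<close>, the quantity compared in the Apery argument.\<close>

lemma nat_submonoid_hull_range:
  assumes "\<And>i. f i \<ge> 0"
  shows "nat_submonoid hull (range f) = range (\<lambda>xs. sum_list (map f xs))"
proof (intro equalityI hull_minimal)
  show "range f \<subseteq> range (\<lambda>xs. sum_list (map f xs))"
  proof
    fix y assume "y \<in> range f"
    then obtain i where "y = f i" by auto
    then show "y \<in> range (\<lambda>xs. sum_list (map f xs))"
      by (intro image_eqI[of _ _ "[i]"]) auto
  qed
  have "sum_list (map f xs) + sum_list (map f ys) \<in> range (\<lambda>xs. sum_list (map f xs))" for xs ys
    by (intro image_eqI[of _ _ "xs @ ys"]) auto
  moreover have "0 \<in> range (\<lambda>xs. sum_list (map f xs))"
    by (intro image_eqI[of _ _ "[]"]) auto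
  ultimately show "nat_submonoid (range (\<lambda>xs. sum_list (map f xs)))"
    by (auto simp: nat_submonoid_def assms intro!: sum_list_nonneg)
  show "range (\<lambda>xs. sum_list (map f xs)) \<subseteq> nat_submonoid hull (range f)"
    by (auto simp: hull_def intro!: nat_submonoid_sum_list)
qed

text \<open>Being a submonoid passes to intersections, except that the empty intersection is
  \<open>UNIV\<close>; nonnegativity of \<open>f\<close> puts \<open>{0..}\<close> among the
  intersected sets.\<close>

lemma nat_submonoid_hull:
  assumes "\<And>i. f i \<ge> 0"
  shows "nat_submonoid (nat_submonoid hull (range f))"
proof -
  have "nat_submonoid {0..}" by (auto simp: nat_submonoid_def)
  with assms have "{0..} \<in> {t. nat_submonoid t \<and> range f \<subseteq> t}" by auto
  then show ?thesis
    unfolding hull_def nat_submonoid_def by auto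
qed

section \<open>Greedy expansions\<close>

lemma A_seq_0 [simp]: "A_seq a 0 = 0"
  by (simp add: A_seq_def)

lemma A_seq_Suc:
  assumes "a \<ge> 2"
  shows "A_seq a (Suc i) = a * A_seq a i + 1"
proof -
  have *: "(a - 1) * A_seq a j = a ^ j - 1" for j
    unfolding A_seq_def
    using power_diff_1_eq[of a j] by (cases "a=1") auto
  have "(a - 1) * A_seq a (Suc i) = (a - 1) * (a * A_seq a i + 1)"
    using *[of i] *[of "Suc i"] by (simp add: algebra_simps)
  then show ?thesis using assms by simp
qed

lemma A_seq_nonneg: "a \<ge> 2 \<Longrightarrow> A_seq a i \<ge> 0"
  by (induction i) (auto simp: A_seq_Suc)

lemma sum_mult_A_seq_nonneg: "a \<ge> 2 \<Longrightarrow> (\<Sum>i\<in>I. int (u i) * A_seq a i) \<ge> 0"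
  by (intro sum_nonneg mult_nonneg_nonneg A_seq_nonneg) auto

lemma A_seq_Suc_pos: "a \<ge> 2 \<Longrightarrow> A_seq a (Suc i) > 0"
  by (auto simp: A_seq_Suc intro!: add_nonneg_pos mult_nonneg_nonneg A_seq_nonneg)

lemma A_seq_mono:
  assumes "a \<ge> 2" "i \<le> j"
  shows "A_seq a i \<le> A_seq a j"
  using assms(2)
proof (rule lift_Suc_mono_le[rotated])
  fix k
  have "1 * A_seq a k \<le> a * A_seq a k"
    using assms(1) by (intro mult_right_mono A_seq_nonneg) auto
  then show "A_seq a k \<le> A_seq a (Suc k)" using assms(1) by (simp add: A_seq_Suc)
qed

text \<open>The digit sum of the greedy expansion of \<open>k\<close> in A_n, ..., A_1. The top
  digit is unbounded, and negative for negative \<open>k\<close>, so copies of A_n can be split off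
  from any integer.\<close>

fun greedy_count :: "int \<Rightarrow> nat \<Rightarrow> int \<Rightarrow> int" where
  "greedy_count a 0 k = 0"
| "greedy_count a (Suc n) k =
    k div A_seq a (Suc n) + greedy_count a n (k mod A_seq a (Suc n))"

lemma greedy_count_0 [simp]: "greedy_count a n 0 = 0"
  by (induction n) auto

lemma greedy_count_add_mult:
  assumes "a \<ge> 2" "n > 0"
  shows "greedy_count a n (q * A_seq a n + r) = q + greedy_count a n r"
proof (cases n)
  case (Suc p)
  then show ?thesis using A_seq_Suc_pos[OF assms(1), of p] by simp
qed (use assms in simp)

lemma greedy_count_less:
  assumes "0 \<le> k" "k < A_seq a (Suc n)"
  shows "greedy_count a (Suc n) k = greedy_count a n k"
  using assms by simp

text \<open>The loss is greatest at a carry, where \<open>a\<close> copies of A_n and the added 1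
  merge into a single A_(n+1).\<close>

lemma greedy_count_le_succ:
  assumes "a \<ge> 2"
  shows "greedy_count a n z \<le> greedy_count a n (z + 1) + (a - 1)"
proof (induction n arbitrary: z)
  case (Suc n)
  define A q r where "A = A_seq a (Suc n)" and "q = (z + 1) div A" and "r = (z + 1) mod A"
  have A: "A > 0" unfolding A_def using assms by (rule A_seq_Suc_pos)
  have z: "z + 1 = q * A + r" by (simp add: q_def r_def)
  have r: "0 \<le> r" "r < A" using A by (auto simp: r_def)
  have 1: "greedy_count a (Suc n) (z + 1) = q + greedy_count a n r"
    by (simp add: q_def r_def A_def)
  show ?case
  proof (cases "r = 0")
    case False
    have "z = q * A + (r - 1)" using z by simp
    then have "greedy_count a (Suc n) z = q + greedy_count a (Suc n) (r - 1)"
      unfolding A_def by (simp only: greedy_count_add_mult[OF assms zero_less_Suc])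
    also have "\<dots> = q + greedy_count a n (r - 1)"
      using greedy_count_less[of "r - 1" a n] r False by (simp add: A_def)
    finally show ?thesis using 1 Suc.IH[of "r - 1"] by simp
  next
    \<comment> \<open>Here \<open>z\<close> sits just below a multiple of A_(n+1), so its remainder
      is A_(n+1) - 1 = a A_n, with at most \<open>a\<close> summands.\<close>
    case True
    then have "z = (q - 1) * A + a * A_seq a n"
      using z A_seq_Suc[OF assms, of n] by (simp add: A_def algebra_simps)
    then have "greedy_count a (Suc n) z = q - 1 + greedy_count a (Suc n) (a * A_seq a n)"
      using greedy_count_add_mult[OF assms, of "Suc n" "q - 1"] by (simp add: A_def)
    also have "\<dots> = q - 1 + greedy_count a n (a * A_seq a n)"
      using assms A_seq_nonneg[OF assms, of n] A_seq_Suc[OF assms, of n]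
      by (subst greedy_count_less) auto
    also have "\<dots> \<le> q - 1 + a"
      using greedy_count_add_mult[OF assms, of n a 0] assms by (cases n) auto
    finally show ?thesis using 1 True by simp
  qed
qed (use assms in auto)

text \<open>Since A_(n+2) = (a - 1) A_(n+1) + A_(n+1) + 1, raising the level adds a - 1 copies of
  A_(n+1) and a unit. The copies make up for the at most a - 1 summands lost to the unit.\<close>

lemma greedy_count_le_carry:
  assumes "a \<ge> 2" "i \<le> Suc n" "0 \<le> r" "r < A_seq a i"
  shows "greedy_count a n r \<le> greedy_count a n (r + (A_seq a (Suc n) - A_seq a i))"
  using assms(2)
proof (induction n)
  case (Suc n)
  show ?case
  proof (cases "i = Suc (Suc n)")
    case False
    with Suc.prems have i: "i \<le> Suc n" by simp
    define y where "y = r + (A_seq a (Suc n) - A_seq a i)"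
    have mono: "A_seq a i \<le> A_seq a (Suc n)" using i assms(1) by (rule A_seq_mono[rotated])
    then have y: "0 \<le> y" "y < A_seq a (Suc n)" using assms by (auto simp: y_def)
    have "greedy_count a (Suc n) r = greedy_count a n r"
      using assms mono by (intro greedy_count_less) auto
    also have "\<dots> \<le> greedy_count a n y" using Suc.IH[OF i] by (simp add: y_def)
    also have "\<dots> = greedy_count a (Suc n) y" using y by (rule greedy_count_less[symmetric])
    also have "\<dots> \<le> (a - 1) + greedy_count a (Suc n) (y + 1)"
      using greedy_count_le_succ[OF assms(1), of "Suc n" y] by simp
    also have "\<dots> = greedy_count a (Suc n) ((a - 1) * A_seq a (Suc n) + (y + 1))"
      using assms(1) by (intro greedy_count_add_mult[symmetric]) auto
    also have "(a - 1) * A_seq a (Suc n) + (y + 1) = r + (A_seq a (Suc (Suc n)) - A_seq a i)"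
      using A_seq_Suc[OF assms(1), of "Suc n"] by (simp add: y_def algebra_simps)
    finally show ?thesis .
  qed simp
qed simp

lemma greedy_count_add_A_seq:
  assumes "a \<ge> 2" "i \<le> n" "0 \<le> k"
  shows "greedy_count a n (k + A_seq a i) \<le> greedy_count a n k + 1"
  using assms(2,3)
proof (induction n arbitrary: k)
  case (Suc n)
  define A q r where "A = A_seq a (Suc n)" and "q = k div A" and "r = k mod A"
  have A: "A > 0" unfolding A_def using assms(1) by (rule A_seq_Suc_pos)
  have k: "k = q * A + r" by (simp add: q_def r_def)
  have r: "0 \<le> r" "r < A" using A by (auto simp: r_def)
  have gk: "greedy_count a (Suc n) k = q + greedy_count a n r"
    by (simp add: q_def r_def A_def)
  have Ai: "0 \<le> A_seq a i" "A_seq a i \<le> A"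
    using A_seq_nonneg A_seq_mono assms(1) Suc.prems by (auto simp: A_def)
  show ?case
  proof (cases "i = Suc n")
    case True
    then show ?thesis
      using greedy_count_add_mult[OF assms(1), of "Suc n" 1 k] by (simp add: add.commute)
  next
    case False
    with Suc.prems have i: "i \<le> n" by simp
    have g: "greedy_count a (Suc n) (k + A_seq a i) = q + greedy_count a (Suc n) (r + A_seq a i)"
      using greedy_count_add_mult[OF assms(1), of "Suc n" q "r + A_seq a i"]
      by (simp add: k A_def add.assoc)
    show ?thesis
    proof (cases "r + A_seq a i < A")
      case True
      then have "greedy_count a (Suc n) (r + A_seq a i) = greedy_count a n (r + A_seq a i)"
        using r Ai by (intro greedy_count_less) (auto simp: A_def)
      then show ?thesis using g gk Suc.IH[OF i r(1)] by simp
    next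
      case False
      \<comment> \<open>Adding A_i carries into the top digit. The old remainder is r' + (A_(n+1) -
        A_i), so the previous lemma shows that the lower digits do not gain summands.\<close>
      define r' where "r' = r + A_seq a i - A"
      have r': "0 \<le> r'" "r' < A_seq a i" "r' < A" using False r Ai by (auto simp: r'_def)
      have "greedy_count a (Suc n) (r + A_seq a i) = 1 + greedy_count a (Suc n) r'"
        using greedy_count_add_mult[OF assms(1), of "Suc n" 1 r'] by (simp add: r'_def A_def)
      also have "greedy_count a (Suc n) r' = greedy_count a n r'"
        using r' by (intro greedy_count_less) (auto simp: A_def)
      also have "\<dots> \<le> greedy_count a n r"
        using greedy_count_le_carry[OF assms(1) _ r'(1,2), of n] i by (simp add: r'_def A_def)
      finally show ?thesis using g gk by simp
    qed
  qed
qed simp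

text \<open>Optimality of greedy expansions, obtained by adding the summands one at a time.\<close>

lemma greedy_count_sum_list_le:
  assumes "a \<ge> 2" "\<forall>i\<in>set xs. i \<le> n"
  shows "greedy_count a n (sum_list (map (A_seq a) xs)) \<le> int (length xs)"
  using assms(2)
proof (induction xs)
  case (Cons i xs)
  have "0 \<le> sum_list (map (A_seq a) xs)"
    using assms(1) by (auto intro!: sum_list_nonneg A_seq_nonneg)
  then show ?case
    using Cons greedy_count_add_A_seq[OF assms(1), of i n "sum_list (map (A_seq a) xs)"]
    by (auto simp: add.commute)
qed simp

section \<open>The tuples of R(a,n) as greedy expansions\<close>

lemma R_set_SucD:
  assumes "u \<in> R_set a (Suc n)"
  shows "restrict u {1..<n} \<in> R_set a n"
proof -
  have "restrict u {1..<n} j = u j" "j \<in> {1..<Suc n}" if "j \<in> {1..<n}" for j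
    using that by auto
  moreover have "restrict u {1..<n} \<in> {1..<n} \<rightarrow>\<^sub>E UNIV" by simp
  ultimately show ?thesis
    using assms unfolding R_set_def mem_Collect_eq by metis
qed

text \<open>A top digit \<open>a\<close> forces all lower digits to vanish and the sum is a A_n =
  A_(n+1) - 1; a smaller top digit leaves room for the lower part, which is below A_n by induction.
  Hence the lower part is the remainder modulo A_n and the digits are the greedy ones.\<close>

lemma R_set_greedy:
  assumes "a \<ge> 2" "u \<in> R_set a (Suc n)"
  shows "(\<Sum>i\<in>{1..<Suc n}. int (u i) * A_seq a i) < A_seq a (Suc n) \<and>
    greedy_count a n (\<Sum>i\<in>{1..<Suc n}. int (u i) * A_seq a i) = (\<Sum>i\<in>{1..<Suc n}. int (u i))"
  using assms(2)
proof (induction n arbitrary: u)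
  case 0
  then show ?case using A_seq_Suc_pos[OF assms(1), of 0] by simp
next
  case (Suc n)
  define t where "t = (\<Sum>i\<in>{1..<Suc n}. int (u i) * A_seq a i)"
  have t: "t < A_seq a (Suc n)" "greedy_count a n t = (\<Sum>i\<in>{1..<Suc n}. int (u i))"
    using Suc.IH[OF R_set_SucD[OF Suc.prems]] by (simp_all add: t_def)
  have t0: "t \<ge> 0"
    unfolding t_def using assms(1) by (rule sum_mult_A_seq_nonneg)
  have sum: "(\<Sum>i\<in>{1..<Suc (Suc n)}. int (u i) * A_seq a i) = int (u (Suc n)) * A_seq a (Suc n) + t"
    by (simp add: t_def)
  have le: "int (u (Suc n)) \<le> a" using Suc.prems by (auto simp: R_set_def)
  have "int (u (Suc n)) * A_seq a (Suc n) + t < A_seq a (Suc (Suc n))"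
  proof (cases "int (u (Suc n)) = a")
    case True
    have "\<forall>j\<in>{1..<Suc (Suc n)}. int (u j) = a \<longrightarrow>
        (\<forall>k\<in>{1..<Suc (Suc n)}. k < j \<longrightarrow> u k = 0)"
      using Suc.prems unfolding R_set_def by blast
    from bspec[OF this, of "Suc n"] True have "u k = 0" if "k \<in> {1..<Suc n}" for k
      using that by simp
    then have "t = 0" unfolding t_def by (intro sum.neutral) simp
    then show ?thesis using True by (simp add: A_seq_Suc[OF assms(1)])
  next
    case False
    then have "int (u (Suc n)) * A_seq a (Suc n) \<le> (a - 1) * A_seq a (Suc n)"
      using le assms(1) by (intro mult_right_mono A_seq_nonneg) auto
    then show ?thesis using t(1) by (simp add: A_seq_Suc[OF assms(1), of "Suc n"] algebra_simps)
  qed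
  moreover have "greedy_count a (Suc n) (int (u (Suc n)) * A_seq a (Suc n) + t) =
      (\<Sum>i\<in>{1..<Suc (Suc n)}. int (u i))"
    using greedy_count_add_mult[OF assms(1), of "Suc n" "int (u (Suc n))" t]
      greedy_count_less[OF t0 t(1)] t(2) by simp
  ultimately show ?case unfolding sum by blast
qed

lemma R_set_exists:
  assumes "a \<ge> 2" "0 \<le> k" "k < A_seq a (Suc n)"
  shows "\<exists>u\<in>R_set a (Suc n). (\<Sum>i\<in>{1..<Suc n}. int (u i) * A_seq a i) = k"
  using assms(2,3)
proof (induction n arbitrary: k)
  case 0
  then have "k = 0" by (simp add: A_seq_Suc[OF assms(1)])
  then show ?case by (simp add: R_set_def)
next
  case (Suc n)
  define A q r where "A = A_seq a (Suc n)" and "q = k div A" and "r = k mod A"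
  have A: "A > 0" unfolding A_def using assms(1) by (rule A_seq_Suc_pos)
  have k: "k = q * A + r" by (simp add: q_def r_def)
  have r: "0 \<le> r" "r < A" using A by (auto simp: r_def)
  have q0: "q \<ge> 0" using Suc.prems A by (simp add: q_def pos_imp_zdiv_nonneg_iff)
  have kle: "q * A + r \<le> a * A"
    using Suc.prems k A_seq_Suc[OF assms(1), of "Suc n"] by (simp add: A_def)
  then have "q * A \<le> a * A" using r by linarith
  then have qa: "q \<le> a" using A by (rule mult_right_le_imp_le)
  obtain u where u: "u \<in> R_set a (Suc n)" "(\<Sum>i\<in>{1..<Suc n}. int (u i) * A_seq a i) = r"
    using Suc.IH[of r] r by (auto simp: A_def)
  \<comment> \<open>As k is at most a A, the quotient can reach \<open>a\<close> only with remainder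
    0; this yields the vanishing condition in \<open>R_set\<close>.\<close>
  have zero: "u j = 0" if "q = a" "j \<in> {1..<Suc n}" for j
  proof -
    have "r = 0" using kle that(1) r by simp
    then have "\<forall>i\<in>{1..<Suc n}. int (u i) * A_seq a i = 0"
      using u(2) assms(1)
      by (subst sum_nonneg_eq_0_iff[symmetric]) (auto intro!: mult_nonneg_nonneg A_seq_nonneg)
    then show ?thesis
      using that(2) A_seq_Suc_pos[OF assms(1), of "j - 1"] by auto
  qed
  define v where "v = u(Suc n := nat q)"
  have "v \<in> R_set a (Suc (Suc n))"
    unfolding R_set_def mem_Collect_eq
  proof (intro conjI ballI impI)
    show "v \<in> {1..<Suc (Suc n)} \<rightarrow>\<^sub>E UNIV"
      using u(1) by (auto simp: R_set_def v_def PiE_def extensional_def)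
  next
    fix j assume "j \<in> {1..<Suc (Suc n)}"
    then show "int (v j) \<le> a"
      using u(1) q0 qa by (cases "j = Suc n") (auto simp: R_set_def v_def)
  next
    fix j k assume j: "j \<in> {1..<Suc (Suc n)}" "int (v j) = a"
      and k: "k \<in> {1..<Suc (Suc n)}" "k < j"
    have k': "k \<in> {1..<Suc n}" and vk: "v k = u k" using j k by (auto simp: v_def)
    show "v k = 0"
    proof (cases "j = Suc n")
      case True
      then show ?thesis using zero[OF _ k'] j(2) q0 vk by (simp add: v_def)
    next
      case False
      then have "j \<in> {1..<Suc n}" "int (u j) = a" using j by (auto simp: v_def)
      then have "u k = 0" using u(1) k' k(2) unfolding R_set_def by blast
      then show ?thesis using vk by simp
    qed
  qed
  moreover have "(\<Sum>i\<in>{1..<Suc (Suc n)}. int (v i) * A_seq a i) = k"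
  proof -
    have "(\<Sum>i\<in>{1..<Suc n}. int (v i) * A_seq a i) = r"
      using u(2) by (simp add: v_def)
    then show ?thesis using k q0 by (simp add: v_def A_def)
  qed
  ultimately show ?case by blast
qed

section \<open>The Apery set\<close>

lemma T_map_funpow:
  assumes "a \<ge> 2"
  shows "(T_map a b ^^ i) m = m + ((a - 1) * m + b) * A_seq a i"
proof (induction i)
  case (Suc i)
  have "(T_map a b ^^ Suc i) m = a * (T_map a b ^^ i) m + b" by (simp add: T_map_def)
  then show ?case unfolding Suc A_seq_Suc[OF assms] by (simp add: algebra_simps)
qed simp

lemma sum_T_map_funpow:
  assumes "a \<ge> 2"
  shows "(\<Sum>i\<in>I. int (u i) * (T_map a b ^^ i) m) =
    (\<Sum>i\<in>I. int (u i)) * m + ((a - 1) * m + b) * (\<Sum>i\<in>I. int (u i) * A_seq a i)"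
  unfolding T_map_funpow[OF assms] sum_distrib_left sum_distrib_right sum.distrib[symmetric]
  by (intro sum.cong refl) (simp add: algebra_simps)

lemma sum_list_T_map_funpow:
  assumes "a \<ge> 2"
  shows "sum_list (map (\<lambda>i. (T_map a b ^^ i) m) xs) =
    int (length xs) * m + ((a - 1) * m + b) * sum_list (map (A_seq a) xs)"
  by (induction xs) (auto simp: T_map_funpow[OF assms] algebra_simps)

text \<open>The bound on \<open>b\<close> says that d is at least m - 2, so only m = 2 with d = 0
  could fail; then b = -(a - 1) m is divisible by m, against coprimality.\<close>

lemma step_pos:
  fixes a b m :: int
  assumes "m > 1" "gcd b m = 1" "b \<ge> - (a - 2) * m - 2"
  shows "(a - 1) * m + b > 0"
proof (rule ccontr)
  assume "\<not> ?thesis"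
  then have "(a - 1) * m + b \<le> 0" by simp
  moreover have "(a - 1) * m + b \<ge> m - 2" using assms(3) by (simp add: algebra_simps)
  ultimately have "m = 2" "(a - 1) * m + b = 0" using assms(1) by linarith+
  then have "m dvd b" by presburger
  then show False using assms(1,2) by (simp add: gcd_proj2_if_dvd)
qed

text \<open>With x = c m + d t and the tuple sum equal to l m + d k, the congruence gives t = k + m
  q, because d is invertible modulo m. What remains is l \<le> c + d q with q \<ge> 0: greedy
  optimality gives it for q = 0, the size of d for q > 0.\<close>

lemma R_below_apery_minimal:
  fixes a b m :: int
  assumes a: "a \<ge> 2" and m: "m > 1" and cop: "gcd b m = 1" and b: "b \<ge> - (a - 2) * m - 2"
    and n: "m \<le> A_seq a (Suc n)"
    and u: "u \<in> R_below m a (Suc n)"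
    and x: "x \<in> range (\<lambda>xs. sum_list (map (\<lambda>i. (T_map a b ^^ i) m) xs))"
    and cong: "m dvd x - (\<Sum>i\<in>{1..<Suc n}. int (u i) * (T_map a b ^^ i) m)"
  shows "(\<Sum>i\<in>{1..<Suc n}. int (u i) * (T_map a b ^^ i) m) \<le> x"
proof -
  define d where "d = (a - 1) * m + b"
  have d: "d > 0" "d \<ge> m - 2"
    using step_pos[OF m cop b] b by (auto simp: d_def algebra_simps)
  have "coprime m d"
  proof -
    have "gcd m (b + (a - 1) * m) = gcd m b"
      using gcd_add_mult[of m "a - 1" b] by (simp add: add.commute)
    then show ?thesis using cop by (simp add: coprime_iff_gcd_eq_1 d_def gcd.commute add.commute)
  qed
  obtain xs where xs: "x = sum_list (map (\<lambda>i. (T_map a b ^^ i) m) xs)" using x by blast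
  define c t where "c = int (length xs)" and "t = sum_list (map (A_seq a) xs)"
  define l k where "l = (\<Sum>i\<in>{1..<Suc n}. int (u i))"
    and "k = (\<Sum>i\<in>{1..<Suc n}. int (u i) * A_seq a i)"
  have xeq: "x = c * m + d * t"
    by (simp only: xs sum_list_T_map_funpow[OF a] c_def t_def d_def)
  have weq: "(\<Sum>i\<in>{1..<Suc n}. int (u i) * (T_map a b ^^ i) m) = l * m + d * k"
    by (simp only: sum_T_map_funpow[OF a] l_def k_def d_def)
  have k: "0 \<le> k" "k < m"
    using u sum_mult_A_seq_nonneg[OF a] unfolding R_below_def k_def by blast+
  have t: "0 \<le> t" unfolding t_def using a by (auto intro!: sum_list_nonneg A_seq_nonneg)
  have lk: "l \<le> k" unfolding l_def k_def
  proof (rule sum_mono)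
    fix i assume "i \<in> {1..<Suc n}"
    then have "A_seq a i \<ge> 1" using A_seq_Suc_pos[OF a, of "i - 1"] by simp
    then have "int (u i) * 1 \<le> int (u i) * A_seq a i" by (rule mult_left_mono) simp
    then show "int (u i) \<le> int (u i) * A_seq a i" by simp
  qed
  have "m dvd (c - l) * m + d * (t - k)"
    using cong unfolding weq xeq by (simp add: algebra_simps)
  then have "m dvd d * (t - k)" by (metis dvd_add_right_iff dvd_triv_right)
  then have "m dvd t - k" using \<open>coprime m d\<close> by (simp add: coprime_dvd_mult_right_iff)
  then obtain q where q: "t = k + m * q" by (metis dvdE diff_eq_eq add.commute)
  have "q > -1"
  proof (rule ccontr)
    assume "\<not> q > -1"
    then have "m * q \<le> m * (-1)" using m by (intro mult_left_mono) auto
    then show False using q t k by linarith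
  qed
  have "l \<le> c + d * q"
  proof (cases "q = 0")
    case True
    \<comment> \<open>A larger index would contribute at least A_(n+1) \<ge> m > k = t.\<close>
    have "\<forall>i\<in>set xs. i \<le> n"
    proof (rule ccontr)
      assume "\<not> ?thesis"
      then obtain i where i: "i \<in> set xs" "Suc n \<le> i" by auto
      have "A_seq a i \<le> t"
        unfolding t_def using i(1) a by (intro member_le_sum_list) (auto intro: A_seq_nonneg)
      then show False using A_seq_mono[OF a i(2)] n k True q by simp
    qed
    then have "greedy_count a n k \<le> c"
      using greedy_count_sum_list_le[OF a, of xs n] True q by (simp add: t_def c_def)
    moreover have "greedy_count a n k = l"
      using R_set_greedy[OF a, of u n] u by (simp add: R_below_def k_def l_def)
    ultimately show ?thesis using True by simp
  next
    case False
    then have "q \<ge> 1" using \<open>q > -1\<close> by simp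
    then have "d * 1 \<le> d * q" "m * 1 \<le> m * q" using d m by (auto intro!: mult_left_mono)
    \<comment> \<open>This unit closes the gap: l \<le> k \<le> m - 1 = 1 + (m - 2) \<le> c +
      d.\<close>
    moreover have "c \<ge> 1"
    proof -
      have "t \<noteq> 0" using calculation q k m by linarith
      then show ?thesis by (cases xs) (auto simp: t_def c_def)
    qed
    ultimately show ?thesis using lk k d by linarith
  qed
  then have "l * m \<le> (c + d * q) * m" using m by (intro mult_right_mono) auto
  then show ?thesis unfolding weq xeq q by (simp add: algebra_simps)
qed

section \<open>Pseudo-Frobenius numbers as Apery elements minus m\<close>

theorem proposition5p2:
  fixes a b m :: int and n :: nat
  assumes "a \<ge> 2" and "m > 1" and "gcd b m = 1" and "b \<ge> - (a - 2) * m - 2"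
    and "n = (LEAST k. k > 0 \<and> A_seq a k \<ge> m)"
  shows "PF (S_monoid a b m) \<subseteq>
    {(\<Sum>i\<in>{1..<n}. int (u i) * (T_map a b ^^ i) m) - m | u. u \<in> Maximals (R_below m a n)}"
proof
  define s where "s = (\<lambda>i. (T_map a b ^^ i) m)"
  define S where "S = S_monoid a b m"
  define w where "w = (\<lambda>u::nat \<Rightarrow> nat. \<Sum>i\<in>{1..<n}. int (u i) * s i)"
  define d where "d = (a - 1) * m + b"
  have d: "d > 0" unfolding d_def using assms(2-4) by (rule step_pos)
  have s_ge: "s i \<ge> m" for i
    using d A_seq_nonneg[OF assms(1), of i] by (simp add: s_def T_map_funpow[OF assms(1)] d_def)
  have s_nonneg: "s i \<ge> 0" for i using s_ge[of i] assms(2) by simp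
  have S_eq: "S = range (\<lambda>xs. sum_list (map s xs))"
    unfolding S_def S_monoid_def s_def[symmetric] using s_nonneg by (rule nat_submonoid_hull_range)
  have sub: "nat_submonoid S"
    unfolding S_def S_monoid_def s_def[symmetric] using s_nonneg by (rule nat_submonoid_hull)
  have s_in: "s i \<in> S" for i
    unfolding S_eq by (intro image_eqI[of _ _ "[i]"]) auto
  have m_in: "m \<in> S" using s_in[of 0] by (simp add: s_def)

  \<comment> \<open>Taking k = m shows that the set defining \<open>n\<close> is nonempty.\<close>
  have "int k \<le> A_seq a k" for k
  proof (induction k)
    case (Suc k)
    have "1 * A_seq a k \<le> a * A_seq a k"
      using assms(1) by (intro mult_right_mono A_seq_nonneg) auto
    then show ?case using Suc by (simp add: A_seq_Suc[OF assms(1)])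
  qed simp
  from this[of "nat m"] have "nat m > 0 \<and> A_seq a (nat m) \<ge> m" using assms(2) by simp
  then have "n > 0 \<and> A_seq a n \<ge> m" unfolding assms(5) by (rule LeastI)
  then obtain p where p: "n = Suc p" "m \<le> A_seq a (Suc p)" by (cases n) auto

  have minimal: "w u \<le> y" if "u \<in> R_below m a n" "y \<in> S" "m dvd y - w u" for u y
    using R_below_apery_minimal[OF assms(1-4) p(2), of u y] that
    by (simp add: w_def p(1) S_eq s_def)

  fix x assume "x \<in> PF (S_monoid a b m)"
  then have x: "x \<notin> S" "\<And>e. e \<in> S \<Longrightarrow> e \<noteq> 0 \<Longrightarrow> x + e \<in> S"
    by (auto simp: PF_def S_def)
  then have "x + m \<in> S" using m_in assms(2) by simp
  then obtain xs where xs: "x + m = sum_list (map s xs)" unfolding S_eq by blast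
  define t where "t = sum_list (map (A_seq a) xs)"
  have xm: "x + m = int (length xs) * m + d * t"
    unfolding xs s_def sum_list_T_map_funpow[OF assms(1)] t_def d_def ..
  \<comment> \<open>Modulo m only d t matters in x + m, so expanding t mod m gives a tuple in the
    same residue class.\<close>
  obtain u where u: "u \<in> R_set a n" "(\<Sum>i\<in>{1..<n}. int (u i) * A_seq a i) = t mod m"
  proof -
    have "0 \<le> t mod m" "t mod m < A_seq a (Suc p)"
      using p(2) assms(2) pos_mod_bound[of m t] pos_mod_sign[of m t] by linarith+
    then show ?thesis using R_set_exists[OF assms(1)] that unfolding p(1) by blast
  qed
  have u_in: "u \<in> R_below m a n" using u assms(2) by (simp add: R_below_def)
  have "w u = (\<Sum>i\<in>{1..<n}. int (u i)) * m + d * (t mod m)"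
    unfolding w_def s_def sum_T_map_funpow[OF assms(1)] u(2) d_def ..
  then have "x + m - w u =
      m * (int (length xs) - (\<Sum>i\<in>{1..<n}. int (u i))) + d * (t - t mod m)"
    unfolding xm by (simp add: algebra_simps)
  then have dvd: "m dvd x + m - w u" by (simp add: minus_mod_eq_mult_div)
  then have le: "w u \<le> x + m" using minimal[OF u_in \<open>x + m \<in> S\<close>] by simp
  have w_in: "w u \<in> S" unfolding w_def by (rule nat_submonoid_sum[OF sub s_in])
  \<comment> \<open>If x + m exceeded \<open>w u\<close> by m j with j > 0, then x = w u + (j - 1) m
    would itself lie in S.\<close>
  have eq: "x = w u - m"
  proof (rule ccontr)
    assume "x \<noteq> w u - m"
    obtain j where j: "x + m - w u = m * j" using dvd by blast
    with le \<open>x \<noteq> w u - m\<close> have "m * j > 0" by simp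
    then have "j > 0" using assms(2) by (simp add: zero_less_mult_iff)
    then have "x = w u + int (nat (j - 1)) * m" using j by (simp add: algebra_simps)
    moreover have "\<dots> \<in> S"
      using sub w_in nat_submonoid_mult[OF sub m_in] unfolding nat_submonoid_def by blast
    ultimately show False using x(1) by simp
  qed
  have "\<not> u < v" if v: "v \<in> R_below m a n" for v
  proof
    assume less: "u < v"
    then have le: "u i \<le> v i" for i by (simp add: less_le le_fun_def)
    define e where "e = (\<Sum>i\<in>{1..<n}. int (v i - u i) * s i)"
    have e_in: "e \<in> S" unfolding e_def by (rule nat_submonoid_sum[OF sub s_in])
    have e: "w u + e = w v"
      by (simp add: w_def e_def sum.distrib[symmetric] of_nat_diff le algebra_simps)
    have "e \<noteq> 0"
    proof
      assume "e = 0"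
      then have "\<forall>i\<in>{1..<n}. int (v i - u i) * s i = 0"
        unfolding e_def by (subst (asm) sum_nonneg_eq_0_iff) (auto intro!: mult_nonneg_nonneg s_nonneg)
      moreover have "s i \<noteq> 0" for i using s_ge[of i] assms(2) by simp
      \<comment> \<open>All generators are positive, so a vanishing \<open>e\<close> leaves no room
        for a strictly larger tuple; outside the index range both tuples take the default
        value.\<close>
      ultimately have "\<forall>i\<in>{1..<n}. v i = u i" using le by (simp add: le_antisym)
      moreover have "v \<in> extensional {1..<n}" "u \<in> extensional {1..<n}"
        using v u(1) by (auto simp: R_below_def R_set_def PiE_def)
      ultimately have "v = u" by (intro extensionalityI) auto
      then show False using less by simp
    qed
    \<comment> \<open>This element is x + e. It is congruent to \<open>w v\<close> modulo m and
      smaller, against minimality of \<open>w v\<close>.\<close>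
    then have "w v - m \<in> S" using x(2)[OF e_in] e eq by (simp add: algebra_simps)
    then have "w v \<le> w v - m" by (rule minimal[OF v]) simp
    then show False using assms(2) by simp
  qed
  then have "u \<in> Maximals (R_below m a n)" using u_in by (auto simp: Maximals_def)
  then show "x \<in> {(\<Sum>i\<in>{1..<n}. int (u i) * (T_map a b ^^ i) m) - m | u.
      u \<in> Maximals (R_below m a n)}"
    using eq unfolding w_def s_def by blast
qed

end
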